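(* Let $G$ be a finite abelian group. The decomposition $q=\tilde q\cdot\eta$ of a weak quadratic form $q\in\mathrm{WQF}(G,\mathbb{k}^\times)$ into a quadratic form $\tilde q\in\mathrm{QF}(G,\mathbb{k}^\times)$ and a character $\eta\in\mathrm{Hom}(G,\mathbb{k}^\times)$ induces a well-defined bijection $$\mathrm{WQF}(G,\mathbb{k}^\times)/\!\sim\;\to\;(\mathrm{QF}(G,\mathbb{k}^\times)\oplus\mathrm{Hom}(G,\mathbb{k}^\times))/\!\sim,\qquad [q]\mapsto[(\tilde q,\eta)].$$
   Context: $\mathbb{k}$ is a field. For $q: G\to\mathbb{k}^\times$ put $\beta_q(g_1,g_2)=q(g_1g_2)q(g_1)^{-1}q(g_2)^{-1}$. $\mathrm{WQF}(G,\mathbb{k}^\times)$ is the group of weak quadratic forms, i.e. maps $q$ with $\beta_q$ a bihomomorphism; $\mathrm{QF}(G,\mathbb{k}^\times)$ is the subgroup of quadratic forms, those with in addition $q(g)=q(g^{-1})$ for all $g\in G$. $\mathrm{Hom}(G,\mathbb{k}^\times)$ is the group of characters, i.e. group homomorphisms $G\to\mathbb{k}^\times$. The decomposition referred to is the paper's: for every weak quadratic form $q$ on a finite abelian group it asserts the existence of a quadratic form $\tilde q$ and a character $\eta$ with $q=\tilde q\cdot\eta$ (and $\beta_q=\beta_{\tilde q}$). On $\mathrm{WQF}(G,\mathbb{k}^\times)$: $q\sim q'$ iff there is $f\in\mathrm{Aut}(G)$ with $q=q'\circ f$. On $\mathrm{QF}(G,\mathbb{k}^\times)\oplus\mathrm{Hom}(G,\mathbb{k}^\times)$: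 $(\tilde q,\eta)\sim(\tilde q',\eta')$ iff there is $f\in\mathrm{Aut}(G)$ with $\tilde q\eta=(\tilde q'\eta')\circ f$.
   Formalization: The existence of a decomposition of every weak quadratic form on G with values in the given field is assumed as a hypothesis, since it fails over some fields (e.g. the rationals with G = Z/4), where the claimed bijection fails too. *)

theory Defs
  imports "HOL-Algebra.Multiplicative_Group" "HOL-Algebra.Bij"
begin

text \<open>
  The group \<open>A\<close> of values is \<^term>\<open>mult_of K\<close>, the multiplicative group of a field \<open>K\<close>, in the
  intended application.  All sets of maps below consist of extensional functions, so that
  equality of maps on \<^term>\<open>carrier G\<close> is equality in HOL.
\<close>

definition bihom :: "('a, 'm) monoid_scheme \<Rightarrow> ('b, 'n) monoid_scheme \<Rightarrow> ('a \<Rightarrow> 'a \<Rightarrow> 'b) \<Rightarrow> bool"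
  where "bihom G A b \<longleftrightarrow>
    (\<forall>g \<in> carrier G. (\<lambda>h. b g h) \<in> hom G A \<and> (\<lambda>h. b h g) \<in> hom G A)"

definition beta ::
    "('a, 'm) monoid_scheme \<Rightarrow> ('b, 'n) monoid_scheme \<Rightarrow> ('a \<Rightarrow> 'b) \<Rightarrow> 'a \<Rightarrow> 'a \<Rightarrow> 'b"
  where "beta G A q g h = q (g \<otimes>\<^bsub>G\<^esub> h) \<otimes>\<^bsub>A\<^esub> inv\<^bsub>A\<^esub> (q g) \<otimes>\<^bsub>A\<^esub> inv\<^bsub>A\<^esub> (q h)"

definition WQF :: "('a, 'm) monoid_scheme \<Rightarrow> ('b, 'n) monoid_scheme \<Rightarrow> ('a \<Rightarrow> 'b) set"
  where "WQF G A = {q \<in> carrier G \<rightarrow>\<^sub>E carrier A. bihom G A (beta G A q)}"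

definition QF :: "('a, 'm) monoid_scheme \<Rightarrow> ('b, 'n) monoid_scheme \<Rightarrow> ('a \<Rightarrow> 'b) set"
  where "QF G A = {q \<in> WQF G A. \<forall>g \<in> carrier G. q g = q (inv\<^bsub>G\<^esub> g)}"

definition Hom :: "('a, 'm) monoid_scheme \<Rightarrow> ('b, 'n) monoid_scheme \<Rightarrow> ('a \<Rightarrow> 'b) set"
  where "Hom G A = hom G A \<inter> extensional (carrier G)"

definition pmult ::
    "('a, 'm) monoid_scheme \<Rightarrow> ('b, 'n) monoid_scheme \<Rightarrow> ('a \<Rightarrow> 'b) \<Rightarrow> ('a \<Rightarrow> 'b) \<Rightarrow> 'a \<Rightarrow> 'b"
  where "pmult G A p r = (\<lambda>g \<in> carrier G. p g \<otimes>\<^bsub>A\<^esub> r g)"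

definition wqf_rel ::
    "('a, 'm) monoid_scheme \<Rightarrow> ('b, 'n) monoid_scheme \<Rightarrow> (('a \<Rightarrow> 'b) \<times> ('a \<Rightarrow> 'b)) set"
  where "wqf_rel G A = {(q, q'). q \<in> WQF G A \<and> q' \<in> WQF G A \<and>
    (\<exists>f \<in> auto G. q = compose (carrier G) q' f)}"

definition pair_rel ::
    "('a, 'm) monoid_scheme \<Rightarrow> ('b, 'n) monoid_scheme \<Rightarrow>
      ((('a \<Rightarrow> 'b) \<times> ('a \<Rightarrow> 'b)) \<times> (('a \<Rightarrow> 'b) \<times> ('a \<Rightarrow> 'b))) set"
  where "pair_rel G A = {((p, e), (p', e')).
    (p, e) \<in> QF G A \<times> Hom G A \<and> (p', e') \<in> QF G A \<times> Hom G A \<and>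
    (\<exists>f \<in> auto G. pmult G A p e = compose (carrier G) (pmult G A p' e') f)}"

text \<open>
  A decomposition of \<open>q\<close> need not exist over an arbitrary field: over the rationals, the weak
  quadratic form on the integers modulo 4 with values \<open>1, 1, -1, -1\<close> at \<open>0, 1, 2, 3\<close> has none,
  since its quadratic part \<open>p\<close> would satisfy \<open>p(1)\<^sup>2 = beta(1,1) = -1\<close>.  Nor is it unique.  It is therefore
  a relation between \<open>q\<close> and the pair.  The equality of the associated bihomomorphisms is a
  consequence, see the lemma \<open>decomposition_beta\<close>.
\<close>

definition decomposition ::
    "('a, 'm) monoid_scheme \<Rightarrow> ('b, 'n) monoid_scheme \<Rightarrow>
      ('a \<Rightarrow> 'b) \<Rightarrow> ('a \<Rightarrow> 'b) \<times> ('a \<Rightarrow> 'b) \<Rightarrow> bool"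
  where "decomposition G A q pe \<longleftrightarrow> pe \<in> QF G A \<times> Hom G A \<and> q = pmult G A (fst pe) (snd pe)"

lemma beta_pmult:
  assumes "comm_group G" "comm_group A"
    and p: "p \<in> carrier G \<rightarrow> carrier A" and e: "e \<in> hom G A"
    and g: "g \<in> carrier G" and h: "h \<in> carrier G"
  shows "beta G A (pmult G A p e) g h = beta G A p g h"
proof -
  interpret G: comm_group G by fact
  interpret A: comm_group A by fact
  have gh: "g \<otimes>\<^bsub>G\<^esub> h \<in> carrier G" using g h by simp
  have c: "p g \<in> carrier A" "p h \<in> carrier A" "p (g \<otimes>\<^bsub>G\<^esub> h) \<in> carrier A"
      "e g \<in> carrier A" "e h \<in> carrier A"
    using p e g h gh by (auto simp: hom_def Pi_iff)
  have m: "e (g \<otimes>\<^bsub>G\<^esub> h) = e g \<otimes>\<^bsub>A\<^esub> e h" using e g h by (simp add: hom_def)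
  have ac: "x \<otimes>\<^bsub>A\<^esub> (a \<otimes>\<^bsub>A\<^esub> b) \<otimes>\<^bsub>A\<^esub> (c \<otimes>\<^bsub>A\<^esub> a') \<otimes>\<^bsub>A\<^esub> (d \<otimes>\<^bsub>A\<^esub> b')
    = x \<otimes>\<^bsub>A\<^esub> c \<otimes>\<^bsub>A\<^esub> d \<otimes>\<^bsub>A\<^esub> ((a \<otimes>\<^bsub>A\<^esub> a') \<otimes>\<^bsub>A\<^esub> (b \<otimes>\<^bsub>A\<^esub> b'))"
    if "x \<in> carrier A" "a \<in> carrier A" "b \<in> carrier A" "c \<in> carrier A" "d \<in> carrier A"
      "a' \<in> carrier A" "b' \<in> carrier A" for x a b c d a' b'
    using that by (simp add: A.m_ac)
  have "p (g \<otimes>\<^bsub>G\<^esub> h) \<otimes>\<^bsub>A\<^esub> (e g \<otimes>\<^bsub>A\<^esub> e h) \<otimes>\<^bsub>A\<^esub> (inv\<^bsub>A\<^esub> p g \<otimes>\<^bsub>A\<^esub> inv\<^bsub>A\<^esub> e g)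
      \<otimes>\<^bsub>A\<^esub> (inv\<^bsub>A\<^esub> p h \<otimes>\<^bsub>A\<^esub> inv\<^bsub>A\<^esub> e h)
    = p (g \<otimes>\<^bsub>G\<^esub> h) \<otimes>\<^bsub>A\<^esub> inv\<^bsub>A\<^esub> p g \<otimes>\<^bsub>A\<^esub> inv\<^bsub>A\<^esub> p h
      \<otimes>\<^bsub>A\<^esub> ((e g \<otimes>\<^bsub>A\<^esub> inv\<^bsub>A\<^esub> e g) \<otimes>\<^bsub>A\<^esub> (e h \<otimes>\<^bsub>A\<^esub> inv\<^bsub>A\<^esub> e h))"
    using c by (intro ac) simp_all
  also have "\<dots> = p (g \<otimes>\<^bsub>G\<^esub> h) \<otimes>\<^bsub>A\<^esub> inv\<^bsub>A\<^esub> p g \<otimes>\<^bsub>A\<^esub> inv\<^bsub>A\<^esub> p h"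
    using c by simp
  finally show ?thesis
    using c g h gh by (simp add: beta_def pmult_def m A.inv_mult)
qed

lemma decomposition_beta:
  assumes "comm_group G" "comm_group A" "decomposition G A q (p, e)"
    and "g \<in> carrier G" "h \<in> carrier G"
  shows "beta G A q g h = beta G A p g h"
  using assms beta_pmult[of G A p e g h]
  by (auto simp: decomposition_def QF_def WQF_def Hom_def PiE_def)

lemma pmult_in_WQF:
  assumes G: "comm_group G" and A: "comm_group A"
    and p: "p \<in> QF G A" and e: "e \<in> Hom G A"
  shows "pmult G A p e \<in> WQF G A"
proof -
  interpret G: comm_group G by fact
  interpret A: comm_group A by fact
  have p': "p \<in> carrier G \<rightarrow> carrier A" and b: "bihom G A (beta G A p)"
    using p by (auto simp: QF_def WQF_def PiE_def)
  have e': "e \<in> hom G A" using e by (simp add: Hom_def)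
  have "pmult G A p e \<in> carrier G \<rightarrow>\<^sub>E carrier A"
    using p' e' by (auto simp: pmult_def hom_def Pi_iff)
  moreover have "bihom G A (beta G A (pmult G A p e))"
    using b beta_pmult[OF G A p' e'] by (simp add: bihom_def hom_def Pi_iff)
  ultimately show ?thesis by (simp add: WQF_def)
qed

lemma auto_rel_equiv:
  assumes G: "group G" and F: "F \<in> S \<rightarrow> extensional (carrier G)"
  shows "equiv S {(x, y). x \<in> S \<and> y \<in> S \<and> (\<exists>f \<in> auto G. F x = compose (carrier G) (F y) f)}"
    (is "equiv S ?R")
proof (rule equivI)
  interpret G: group G by fact
  interpret AG: group "AutoGroup G" by (rule G.AutoGroup)
  have car: "carrier (AutoGroup G) = auto G" by (simp add: AutoGroup_def)
  have Bij: "f \<in> Bij (carrier G)" if "f \<in> auto G" for f using that by (simp add: auto_def)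
  show "?R \<subseteq> S \<times> S" by auto
  show "refl_on S ?R"
  proof (rule refl_onI)
    fix x assume x: "x \<in> S"
    hence "F x = compose (carrier G) (F x) (\<lambda>g \<in> carrier G. g)"
      using F by (auto simp: compose_def extensional_def restrict_def fun_eq_iff Pi_iff)
    thus "(x, x) \<in> ?R" using x G.id_in_auto by blast
  qed
  show "sym ?R"
  proof (rule symI)
    fix x y assume "(x, y) \<in> ?R"
    then obtain f where f: "x \<in> S" "y \<in> S" "f \<in> auto G" "F x = compose (carrier G) (F y) f" by blast
    let ?i = "restrict (inv_into (carrier G) f) (carrier G)"
    have bij: "bij_betw f (carrier G) (carrier G)" using Bij[OF f(3)] by (simp add: Bij_def)
    have i: "?i \<in> auto G"
      using f(3) Bij G.restrict_inv_into_hom restrict_inv_into_Bij by (auto simp: auto_def)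
    have "compose (carrier G) (F x) ?i = F y"
    proof
      fix g
      show "compose (carrier G) (F x) ?i g = F y g"
      proof (cases "g \<in> carrier G")
        case True
        thus ?thesis
          using bij by (simp add: f(4) compose_def bij_betw_inv_into_right bij_betw_def inv_into_into)
      next
        case False
        thus ?thesis using F f(2) by (auto simp: compose_def extensional_def Pi_iff)
      qed
    qed
    hence "\<exists>f \<in> auto G. F y = compose (carrier G) (F x) f" using i by metis
    thus "(y, x) \<in> ?R" using f by blast
  qed
  show "trans ?R"
  proof (rule transI)
    fix x y z assume "(x, y) \<in> ?R" "(y, z) \<in> ?R"
    then obtain f f' where f: "x \<in> S" "f \<in> auto G" "F x = compose (carrier G) (F y) f"
      and f': "z \<in> S" "f' \<in> auto G" "F y = compose (carrier G) (F z) f'" by blast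
    have fG: "f \<in> carrier G \<rightarrow> carrier G" using f(2) by (auto simp: auto_def hom_def)
    have "compose (carrier G) f' f \<in> auto G"
      using AG.m_closed[of f' f] f(2) f'(2) Bij
      by (simp add: car) (simp add: AutoGroup_def BijGroup_def)
    moreover have "F x = compose (carrier G) (F z) (compose (carrier G) f' f)"
      using f(3) f'(3) compose_assoc[OF fG, of "F z" f'] by simp
    ultimately show "(x, z) \<in> ?R" using f f' by blast
  qed
qed

lemma equiv_wqf_rel:
  assumes "comm_group G"
  shows "equiv (WQF G A) (wqf_rel G A)"
proof -
  interpret G: comm_group G by fact
  have "(\<lambda>q. q) \<in> WQF G A \<rightarrow> extensional (carrier G)" by (auto simp: WQF_def PiE_def)
  from auto_rel_equiv[OF G.group_axioms this] show ?thesis by (simp add: wqf_rel_def)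
qed

lemma equiv_pair_rel:
  assumes "comm_group G"
  shows "equiv (QF G A \<times> Hom G A) (pair_rel G A)"
proof -
  interpret G: comm_group G by fact
  have "(\<lambda>(p, e). pmult G A p e) \<in> QF G A \<times> Hom G A \<rightarrow> extensional (carrier G)"
    by (auto simp: pmult_def)
  moreover have "pair_rel G A = {(x, y). x \<in> QF G A \<times> Hom G A \<and> y \<in> QF G A \<times> Hom G A \<and>
      (\<exists>f \<in> auto G. (\<lambda>(p, e). pmult G A p e) x =
        compose (carrier G) ((\<lambda>(p, e). pmult G A p e) y) f)}"
    by (auto simp: pair_rel_def)
  ultimately show ?thesis using auto_rel_equiv[OF G.group_axioms] by simp
qed

end

theory Submission
  imports Defs
begin

text \<open>
  The equivalence relation on pairs is the pullback of the one on weak quadratic forms along the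
  multiplication map \<open>(p, e) \<mapsto> p \<cdot> e\<close>.  This map is onto because every weak quadratic form has
  a decomposition, and a surjection induces a bijection from the quotient by a pulled-back
  equivalence relation.  The map of the theorem is its inverse, taking preimages of classes; it does
  not depend on the choice of decompositions.
\<close>

text \<open>Both sides consist of the \<open>x\<close> in \<open>B\<close> with \<open>m x\<close>
  related to \<open>m b\<close>. This one computation shows that preimages of classes are classes
  and gives the value of the bijection at a decomposed form.\<close>

lemma pullback_class:
  assumes "r = {(x, y) \<in> B \<times> B. (m x, m y) \<in> s}" and "b \<in> B"
  shows "m -` (s `` {m b}) \<inter> B = r `` {b}"
  using assms by auto

lemma bij_betw_quotient_pullback:
  assumes s: "equiv A s" and m: "m ` B = A"
    and r: "r = {(x, y) \<in> B \<times> B. (m x, m y) \<in> s}"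
  shows "bij_betw (\<lambda>X. m -` X \<inter> B) (A // s) (B // r)"
proof (rule bij_betwI')
  fix X Y assume "X \<in> A // s" "Y \<in> A // s"
  \<comment> \<open>Sets inside the image of \<open>m\<close> are recovered from their preimages,
    which gives injectivity.\<close>
  hence "X \<subseteq> m ` B" "Y \<subseteq> m ` B" using s m by (auto dest: in_quotient_imp_subset)
  thus "(m -` X \<inter> B = m -` Y \<inter> B) = (X = Y)" by blast
next
  fix X assume "X \<in> A // s"
  then obtain b where "b \<in> B" "X = s `` {m b}" using m by (auto elim!: quotientE)
  thus "m -` X \<inter> B \<in> B // r" using pullback_class[OF r] by (auto intro: quotientI)
next
  fix Y assume "Y \<in> B // r"
  then obtain b where b: "b \<in> B" "Y = r `` {b}" by (auto elim!: quotientE)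
  hence "Y = m -` (s `` {m b}) \<inter> B" using pullback_class[OF r] by simp
  moreover have "s `` {m b} \<in> A // s" using b m by (auto intro: quotientI)
  ultimately show "\<exists>X \<in> A // s. Y = m -` X \<inter> B" by blast
qed

lemma (in field) comm_group_mult_of: "comm_group (mult_of R)"
  by (rule group.group_comm_groupI[OF field_mult_group]) (simp add: m_comm)

text \<open>Well-definedness is expressed by letting \<open>pe\<close> range over all decompositions
  of \<open>q\<close>. Their existence, which can fail over some fields, is the hypothesis
  \<open>decomposable\<close>.\<close>

theorem lemma4p2p9:
  fixes G :: "('a, 'm) monoid_scheme" and K :: "('k, 'n) ring_scheme"
  assumes "comm_group G" and "finite (carrier G)" and "field K"
    and decomposable: "\<And>q. q \<in> WQF G (mult_of K) \<Longrightarrow> \<exists>pe. decomposition G (mult_of K) q pe"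
  shows "\<exists>\<Phi>.
    bij_betw \<Phi> (WQF G (mult_of K) // wqf_rel G (mult_of K))
      ((QF G (mult_of K) \<times> Hom G (mult_of K)) // pair_rel G (mult_of K)) \<and>
    (\<forall>q \<in> WQF G (mult_of K). \<forall>pe. decomposition G (mult_of K) q pe \<longrightarrow>
      \<Phi> (wqf_rel G (mult_of K) `` {q}) = pair_rel G (mult_of K) `` {pe})"
proof -
  let ?A = "mult_of K" and ?B = "QF G (mult_of K) \<times> Hom G (mult_of K)"
  define m where "m = (\<lambda>pe. pmult G ?A (fst pe) (snd pe))"
  have A: "comm_group ?A" using \<open>field K\<close> by (rule field.comm_group_mult_of)
  have into: "m x \<in> WQF G ?A" if "x \<in> ?B" for x
    using that pmult_in_WQF[OF \<open>comm_group G\<close> A] by (auto simp: m_def)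
  have onto: "m ` ?B = WQF G ?A"
  proof
    show "m ` ?B \<subseteq> WQF G ?A" using into by blast
    show "WQF G ?A \<subseteq> m ` ?B" using decomposable unfolding decomposition_def m_def by blast
  qed
  have "(x, y) \<in> pair_rel G ?A \<longleftrightarrow> x \<in> ?B \<and> y \<in> ?B \<and> (m x, m y) \<in> wqf_rel G ?A" for x y
    \<comment> \<open>\<open>wqf_rel\<close> also requires both products to be weak quadratic forms;
      \<open>into\<close> supplies this.\<close>
    using into[of x] into[of y]
    unfolding pair_rel_def wqf_rel_def m_def mem_Collect_eq case_prod_unfold fst_conv snd_conv
      prod.collapse by blast
  hence r: "pair_rel G ?A = {(x, y) \<in> ?B \<times> ?B. (m x, m y) \<in> wqf_rel G ?A}"
    by (intro equalityI subrelI) (simp_all only: mem_Collect_eq prod.case mem_Sigma_iff simp_thms)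
  show ?thesis
  proof (intro exI conjI ballI allI impI)
    show "bij_betw (\<lambda>X. m -` X \<inter> ?B) (WQF G ?A // wqf_rel G ?A) (?B // pair_rel G ?A)"
      by (rule bij_betw_quotient_pullback[OF equiv_wqf_rel[OF \<open>comm_group G\<close>] onto r])
    fix q pe assume "decomposition G ?A q pe"
    \<comment> \<open>A decomposition says \<open>q = m pe\<close> with \<open>pe\<close> in the
      domain of \<open>m\<close>, so \<open>pullback_class\<close> applies with
      \<open>b = pe\<close>.\<close>
    thus "m -` (wqf_rel G ?A `` {q}) \<inter> ?B = pair_rel G ?A `` {pe}"
      using pullback_class[OF r] by (simp add: decomposition_def m_def)
  qed
qed

end
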